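(* Each of the following Diophantine equations has exactly three solutions $(x,n)$ in positive integers, with the values of $n$ as indicated: \begin{itemize} \item $x^2=6^{n}+2185$: $n=3,4,6$; \item $x^2=6^{n}+274837012705$: $n=4,12,13$; \item $x^2=12^{n}+25029865$: $n=2,6,8$. \end{itemize} *)

theory Defs
  imports Main
begin

definition solutions :: "nat \<Rightarrow> nat \<Rightarrow> (nat \<times> nat) set" where
  "solutions b d = {(x, n). x > 0 \<and> n > 0 \<and> x\<^sup>2 = b ^ n + d}"

end

theory Submission
  imports Defs "HOL-Number_Theory.Number_Theory"
begin

text \<open>
  Odd powers of 12 are excluded modulo 5, and for an even exponent \<open>n = 2 m\<close> the factorisation
  \<open>(x - b ^ m) * (x + b ^ m) = d\<close> bounds \<open>m\<close>. For base 6 and odd \<open>n = 2 m + 1\<close> put \<open>y = 6 ^ m\<close>;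
  then \<open>x + y \<surd>6\<close> has norm \<open>d\<close> in \<open>\<int>[\<surd>6]\<close>. Every prime factor of \<open>d\<close> is up to sign a norm there, so up
  to sign and conjugation \<open>x + y \<surd>6 = c * (5 + 2 \<surd>6) ^ k\<close> with \<open>c\<close> in an explicit finite list.
  If \<open>2 ^ 10\<close> divides \<open>y\<close>, then for each \<open>c\<close> the residue of \<open>k\<close> modulo a power of 2 is determined, hence
  so is the residue of \<open>y\<close> up to sign modulo each of the primes 5, 7, 31, 5119, modulo which
  \<open>5 + 2 \<surd>6\<close> has 2-power order. For one of these primes that residue is not plus or minus a power
  of 6.
\<close>

section \<open>Arithmetic in the ring of integers with \<open>\<surd>6\<close> adjoined\<close>

text \<open>The pair \<open>(a, b)\<close> stands for \<open>a + b \<surd>6\<close>.\<close>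

type_synonym qint = "int \<times> int"

fun qmul :: "qint \<Rightarrow> qint \<Rightarrow> qint" where
  "qmul (a, b) (c, d) = (a * c + 6 * b * d, a * d + b * c)"

fun qnorm :: "qint \<Rightarrow> int" where
  "qnorm (a, b) = a\<^sup>2 - 6 * b\<^sup>2"

fun qcnj :: "qint \<Rightarrow> qint" where
  "qcnj (a, b) = (a, - b)"

fun qneg :: "qint \<Rightarrow> qint" where
  "qneg (a, b) = (- a, - b)"

fun qred :: "int \<Rightarrow> qint \<Rightarrow> qint" where
  "qred N (a, b) = (a mod N, b mod N)"

lemma qred_qred: "qred N (qred N x) = qred N x"
  by (cases x) simp

lemma qmul_assoc: "qmul (qmul x y) z = qmul x (qmul y z)"
  by (cases x; cases y; cases z) (simp add: algebra_simps)

lemma qmul_commute: "qmul x y = qmul y x"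
  by (cases x; cases y) (simp add: algebra_simps)

lemma qmul_one: "qmul x (1, 0) = x"
  by (cases x) simp

lemma qmul_qneg: "qmul x (qneg y) = qneg (qmul x y)"
  by (cases x; cases y) simp

lemma qcnj_qmul: "qcnj (qmul x y) = qmul (qcnj x) (qcnj y)"
  by (cases x; cases y) simp

lemma qcnj_qcnj [simp]: "qcnj (qcnj x) = x"
  by (cases x) simp

lemma snd_qcnj [simp]: "snd (qcnj x) = - snd x"
  by (cases x) simp

lemma snd_qneg [simp]: "snd (qneg x) = - snd x"
  by (cases x) simp

lemma qnorm_qmul: "qnorm (qmul x y) = qnorm x * qnorm y"
  by (cases x; cases y) (simp add: algebra_simps power2_eq_square)

lemma qnorm_qcnj [simp]: "qnorm (qcnj x) = qnorm x"
  by (cases x) simp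

lemma qred_qmul: "qred N (qmul (qred N x) (qred N y)) = qred N (qmul x y)"
  by (cases x; cases y) (auto simp: cong_def[symmetric] intro!: cong_add cong_mult)

lemma funpow_qmul: "(qmul e ^^ k) (qmul c z) = qmul c ((qmul e ^^ k) z)"
  by (induction k) (simp_all, metis qmul_assoc qmul_commute)

lemma funpow_qmul_even: "(qmul e ^^ (2 * k)) c = (qmul (qmul e e) ^^ k) c"
  by (induction k) (simp_all add: qmul_assoc)

lemma funpow_qmul_odd: "(qmul e ^^ Suc (2 * k)) c = (qmul (qmul e e) ^^ k) (qmul e c)"
  by (simp add: funpow_qmul_even funpow_qmul del: funpow.simps add: funpow_Suc_right)

lemma qred_funpow_qmul: "qred N ((qmul (qred N e) ^^ k) (qred N c)) = qred N ((qmul e ^^ k) c)"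
proof (induction k)
  case 0
  show ?case by (cases c) simp
next
  case (Suc k)
  have "qred N ((qmul (qred N e) ^^ Suc k) (qred N c))
      = qred N (qmul (qred N (qred N e)) (qred N ((qmul (qred N e) ^^ k) (qred N c))))"
    by (simp add: qred_qmul)
  also have "\<dots> = qred N (qmul (qred N e) (qred N ((qmul e ^^ k) c)))"
    unfolding Suc by (cases e) simp
  finally show ?case by (simp add: qred_qmul)
qed

section \<open>Norm equations\<close>

text \<open>Descent: multiplying by the inverse \<open>(5, -2)\<close> of the fundamental unit gives
  a solution with smaller \<open>v\<close>, down to \<open>(1, 0)\<close>.\<close>

lemma qnorm_one_nonneg:
  assumes "u > 0" "v \<ge> 0" "qnorm (u, v) = 1"
  shows "\<exists>k. (u, v) = (qmul (5, 2) ^^ k) (1, 0)"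
  using assms
proof (induction "nat v" arbitrary: u v rule: less_induct)
  case less
  have eq: "u\<^sup>2 = 6 * v\<^sup>2 + 1" using less.prems by simp
  show ?case
  proof (cases "v = 0")
    case True
    then have "u = 1" using eq less.prems by (simp add: power2_eq_1_iff)
    then have "(u, v) = (qmul (5, 2) ^^ 0) (1, 0)" using True by simp
    then show ?thesis by blast
  next
    case False
    have "v \<noteq> 1"
    proof
      assume "v = 1"
      then have u7: "u\<^sup>2 = 7" using eq by simp
      then have "u\<^sup>2 < 3\<^sup>2" by simp
      then have "u < 3" by (rule power2_less_imp_less) simp
      then have "u = 1 \<or> u = 2" using less.prems by auto
      then show False using u7 by auto
    qed
    then have v2: "v \<ge> 2" using False less.prems by linarith
    then have "v\<^sup>2 \<ge> 4" using power_mono[of 2 v 2] by simp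
    \<comment> \<open>In order, these make the new second coordinate \<open>5 * v - 2 * u\<close>
      nonnegative and smaller than \<open>v\<close>, and the new first coordinate positive. The
      first one is where \<open>v \<ge> 2\<close> enters.\<close>
    then have sq: "(2 * u)\<^sup>2 \<le> (5 * v)\<^sup>2" "(2 * v)\<^sup>2 < u\<^sup>2" "(12 * v)\<^sup>2 < (5 * u)\<^sup>2"
      unfolding power_mult_distrib eq by simp_all
    have a: "2 * u \<le> 5 * v" using sq(1) by (rule power2_le_imp_le) (use v2 in simp)
    have b: "2 * v < u" using sq(2) by (rule power2_less_imp_less) (use less.prems in simp)
    have c: "12 * v < 5 * u" using sq(3) by (rule power2_less_imp_less) (use less.prems in simp)
    have "qnorm (5 * u - 12 * v, 5 * v - 2 * u) = 1"
      using less.prems by (simp add: power2_eq_square algebra_simps)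
    moreover have "nat (5 * v - 2 * u) < nat v" "5 * u - 12 * v > 0" "5 * v - 2 * u \<ge> 0"
      using a b c v2 by linarith+
    ultimately obtain k where "(5 * u - 12 * v, 5 * v - 2 * u) = (qmul (5, 2) ^^ k) (1, 0)"
      using less.hyps by blast
    then have "(qmul (5, 2) ^^ Suc k) (1, 0) = qmul (5, 2) (5 * u - 12 * v, 5 * v - 2 * u)"
      by simp
    also have "\<dots> = (u, v)" by simp
    finally show ?thesis by metis
  qed
qed

lemma qnorm_one:
  assumes "qnorm w = 1"
  shows "\<exists>k. let t = (qmul (5, 2) ^^ k) (1, 0) in w \<in> {t, qneg t, qcnj t, qneg (qcnj t)}"
proof -
  obtain u v where w: "w = (u, v)" by (cases w)
  have "u \<noteq> 0"
  proof
    assume "u = 0"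
    then have "- 6 * v\<^sup>2 = 1" using assms w by simp
    then show False using zero_le_power2[of v] by linarith
  qed
  then obtain k where k: "(\<bar>u\<bar>, \<bar>v\<bar>) = (qmul (5, 2) ^^ k) (1, 0)"
    using qnorm_one_nonneg[of "\<bar>u\<bar>" "\<bar>v\<bar>"] assms w by auto
  show ?thesis
    by (rule exI[of _ k]) (auto simp: k[symmetric] w abs_if)
qed

text \<open>The prime divides \<open>(a * y - b * x) * (a * y + b * x)\<close>, hence one factor;
  which one decides between \<open>g\<close> and its conjugate.\<close>

lemma qnorm_prime_divisor:
  assumes p: "prime \<bar>qnorm g\<bar>" and dvd: "qnorm g dvd qnorm z"
  shows "\<exists>w. z = qmul g w \<or> z = qmul (qcnj g) w"
proof -
  have main: "\<exists>w. z = qmul h w"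
    if h: "h = (a, b)" "z = (x, y)" "qnorm h = s" "s dvd a * y - b * x" "prime \<bar>s\<bar>" "s dvd qnorm z"
    for h a b x y s
  proof -
    \<comment> \<open>The coordinates of \<open>z\<close> times the conjugate of \<open>h\<close>
      are \<open>a * x - 6 * b * y\<close> and \<open>a * y - b * x\<close>. Once \<open>s\<close>
      divides both, the quotient by \<open>s\<close>, the norm of \<open>h\<close>, is
      \<open>z / h\<close>.\<close>
    have "(a * x - 6 * b * y)\<^sup>2 = qnorm h * qnorm z + 6 * (a * y - b * x)\<^sup>2"
      unfolding h(1,2) by (simp add: power2_eq_square algebra_simps)
    then have "s dvd (a * x - 6 * b * y)\<^sup>2" using h by (simp add: power2_eq_square)
    then have "s dvd a * x - 6 * b * y"
      using prime_dvd_power[of "\<bar>s\<bar>" "a * x - 6 * b * y" 2] h by simp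
    then obtain m where m: "a * x - 6 * b * y = s * m" by (elim dvdE)
    obtain n where n: "a * y - b * x = s * n" using h by (elim dvdE)
    have s: "s = a * a - 6 * b * b" "s \<noteq> 0" using h by (auto simp: power2_eq_square)
    have "s * (a * m + 6 * b * n) = a * (s * m) + 6 * b * (s * n)" by (simp add: algebra_simps)
    also have "\<dots> = a * (a * x - 6 * b * y) + 6 * b * (a * y - b * x)" by (simp only: m n)
    also have "\<dots> = s * x" unfolding s(1) by (simp add: algebra_simps)
    finally have 1: "x = a * m + 6 * b * n" using s(2) by simp
    have "s * (a * n + b * m) = a * (s * n) + b * (s * m)" by (simp add: algebra_simps)
    also have "\<dots> = a * (a * y - b * x) + b * (a * x - 6 * b * y)" by (simp only: m n)
    also have "\<dots> = s * y" unfolding s(1) by (simp add: algebra_simps)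
    finally have "y = a * n + b * m" using s(2) by simp
    then have "z = qmul h (m, n)" using 1 h by simp
    then show ?thesis by blast
  qed
  obtain a b x y where g: "g = (a, b)" and z: "z = (x, y)" by (cases g; cases z)
  have "(a * y - b * x) * (a * y - (- b) * x) = y\<^sup>2 * qnorm g - b\<^sup>2 * qnorm z"
    unfolding g z by (simp add: power2_eq_square algebra_simps)
  then have "qnorm g dvd (a * y - b * x) * (a * y - (- b) * x)"
    using dvd by simp
  then have "qnorm g dvd a * y - b * x \<or> qnorm g dvd a * y - (- b) * x"
    using prime_dvd_mult_iff[OF p] by simp
  then show ?thesis
  proof
    assume "qnorm g dvd a * y - b * x"
    from main[OF g z refl this p dvd] show ?thesis by blast
  next
    assume "qnorm g dvd a * y - (- b) * x"
    from main[OF _ z _ this p dvd, of "qcnj g"] g show ?thesis by auto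
  qed
qed

text \<open>For elements of prime norm up to sign, these represent, up to units of norm 1 and with
  possible repetitions, all elements whose norm is the product of the given norms.\<close>

fun norm_classes :: "qint list \<Rightarrow> qint list" where
  "norm_classes [] = [(1, 0)]"
| "norm_classes (g # gs) =
     (let cs = norm_classes gs in map (qmul g) cs @ map (qmul (qcnj g)) cs)"

lemma qcnj_norm_classes: "c \<in> set (norm_classes gs) \<Longrightarrow> qcnj c \<in> set (norm_classes gs)"
proof (induction gs arbitrary: c)
  case (Cons g gs)
  then obtain d where d: "d \<in> set (norm_classes gs)" and "c = qmul g d \<or> c = qmul (qcnj g) d"
    unfolding norm_classes.simps Let_def set_append set_map by blast
  then have "qcnj c = qmul (qcnj g) (qcnj d) \<or> qcnj c = qmul g (qcnj d)"
    by (metis qcnj_qmul qcnj_qcnj)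
  then show ?case
    using Cons.IH[OF d] unfolding norm_classes.simps Let_def set_append set_map by blast
qed simp

lemma qnorm_eq_prod_list:
  assumes "qnorm z = prod_list (map qnorm gs)" "\<forall>g\<in>set gs. prime \<bar>qnorm g\<bar>"
  shows "\<exists>c\<in>set (norm_classes gs). \<exists>w. qnorm w = 1 \<and> z = qmul c w"
  using assms
proof (induction gs arbitrary: z)
  case Nil
  then show ?case by (cases z) auto
next
  case (Cons g gs)
  have "prime \<bar>qnorm g\<bar>" "qnorm g dvd qnorm z" using Cons.prems by auto
  then obtain h w where h: "h = g \<or> h = qcnj g" and w: "z = qmul h w"
    using qnorm_prime_divisor by metis
  have "qnorm g * qnorm w = qnorm g * prod_list (map qnorm gs)"
    using Cons.prems(1) w h by (auto simp: qnorm_qmul)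
  moreover have "qnorm g \<noteq> 0" using Cons.prems(2) by auto
  ultimately have "qnorm w = prod_list (map qnorm gs)" by simp
  moreover have "\<forall>g\<in>set gs. prime \<bar>qnorm g\<bar>" using Cons.prems(2) by simp
  ultimately obtain c t where ct: "c \<in> set (norm_classes gs)" "qnorm t = 1" "w = qmul c t"
    using Cons.IH by blast
  then have "z = qmul (qmul h c) t" "qmul h c \<in> set (norm_classes (g # gs))"
    using w h by (auto simp: qmul_assoc Let_def)
  then show ?case using ct by blast
qed

text \<open>Nonnegative powers suffice: the inverse of a unit of norm 1 is its conjugate, and
  conjugation can be moved onto \<open>c\<close> at the cost of a sign in the second
  coordinate.\<close>

lemma qnorm_eq_orbit:
  assumes "qnorm z = prod_list (map qnorm gs)" "\<forall>g\<in>set gs. prime \<bar>qnorm g\<bar>"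
  shows "\<exists>c\<in>set (norm_classes gs). \<exists>k. \<bar>snd ((qmul (5, 2) ^^ k) c)\<bar> = \<bar>snd z\<bar>"
proof -
  obtain c w where cw: "c \<in> set (norm_classes gs)" "qnorm w = 1" "z = qmul c w"
    using qnorm_eq_prod_list[OF assms] by blast
  obtain k t where t: "t = (qmul (5, 2) ^^ k) (1, 0)" "w \<in> {t, qneg t, qcnj t, qneg (qcnj t)}"
    using qnorm_one[OF cw(2)] unfolding Let_def by blast
  have orb: "(qmul (5, 2) ^^ k) d = qmul d t" for d
    using funpow_qmul[of k "(5, 2)" d "(1, 0)"] t by (simp add: qmul_one)
  have cnj: "\<bar>snd (qmul (qcnj c) t)\<bar> = \<bar>snd (qmul c (qcnj t))\<bar>"
    using qcnj_qmul[of c "qcnj t"] by (metis abs_minus_cancel qcnj_qcnj snd_qcnj)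
  from t(2) consider "w \<in> {t, qneg t}" | "w \<in> {qcnj t, qneg (qcnj t)}" by blast
  then show ?thesis
  proof cases
    case 1
    then have "\<bar>snd (qmul c t)\<bar> = \<bar>snd z\<bar>" using cw by (auto simp: qmul_qneg)
    then show ?thesis using cw orb by metis
  next
    case 2
    then have "\<bar>snd (qmul (qcnj c) t)\<bar> = \<bar>snd z\<bar>" using cw cnj by (auto simp: qmul_qneg)
    then show ?thesis using qcnj_norm_classes[OF cw(1)] orb by metis
  qed
qed

section \<open>Sieving the orbits of the fundamental unit\<close>

text \<open>The exponent is an integer because \<open>code_simp\<close> computes with \<open>nat\<close> in unary.\<close>

function pow_mod :: "int \<Rightarrow> int \<Rightarrow> int \<Rightarrow> int" where
  "pow_mod q b h =
     (if h \<le> 0 then 1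
      else let p = pow_mod q (b * b mod q) (h div 2) in if even h then p else b * p mod q)"
  by pat_completeness auto
termination by (relation "measure (\<lambda>(q, b, h). nat h)") auto

declare pow_mod.simps [simp del]

lemma pow_mod: "[pow_mod q b h = b ^ nat h] (mod q)"
proof (induction q b h rule: pow_mod.induct)
  case (1 q b h)
  show ?case
  proof (cases "h \<le> 0")
    case True
    then show ?thesis by (simp add: pow_mod.simps)
  next
    case False
    let ?p = "pow_mod q (b * b mod q) (h div 2)"
    have "[?p = (b * b mod q) ^ nat (h div 2)] (mod q)" using 1 False by simp
    also have "[(b * b mod q) ^ nat (h div 2) = (b * b) ^ nat (h div 2)] (mod q)"
      by (intro cong_pow) (simp add: cong_def)
    also have "(b * b) ^ nat (h div 2) = b ^ (2 * nat (h div 2))"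
      by (simp add: power_mult power2_eq_square)
    finally have p: "[?p = b ^ (2 * nat (h div 2))] (mod q)" .
    show ?thesis
    proof (cases "even h")
      case True
      then have "nat h = 2 * nat (h div 2)" using False by (auto elim: evenE)
      then show ?thesis using p True False by (simp add: pow_mod.simps[of q b h] Let_def)
    next
      case odd: False
      have "nat h = Suc (2 * nat (h div 2))" using False odd by (auto elim!: oddE)
      moreover have "[b * ?p mod q = b * b ^ (2 * nat (h div 2))] (mod q)"
        using cong_mult[OF cong_refl p, of b] by (simp add: cong_def)
      ultimately show ?thesis using odd False by (simp add: pow_mod.simps[of q b h] Let_def)
    qed
  qed
qed

text \<open>
  An entry \<open>(q, h, r)\<close> is a constraint \<open>y ^ nat h mod q = r\<close>. It has the same truth value for all
  elements \<open>c * e ^ k\<close> when \<open>e\<close> is modulo \<open>q\<close> a rational integer whose \<open>h\<close>-th power is 1.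
\<close>

fun refutes :: "qint \<Rightarrow> qint \<Rightarrow> int \<times> int \<times> int \<Rightarrow> bool" where
  "refutes e c (q, h, r) =
     (snd e mod q = 0 \<and> pow_mod q (fst e) h mod q = 1 \<and> pow_mod q (snd c) h mod q \<noteq> r)"

text \<open>Each level of the recursion splits the exponent \<open>k\<close> by parity, replacing \<open>e\<close> by \<open>e\<^sup>2\<close>.\<close>

fun orbit_sieve :: "int \<Rightarrow> (int \<times> int \<times> int) list list \<Rightarrow> qint \<Rightarrow> qint \<Rightarrow> bool" where
  "orbit_sieve N [] e c = False"
| "orbit_sieve N (t # ts) e c =
     (list_ex (refutes e c) t \<or>
      orbit_sieve N ts (qred N (qmul e e)) c \<and>
      orbit_sieve N ts (qred N (qmul e e)) (qred N (qmul e c)))"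

lemma refutes_sound:
  assumes "refutes e c (q, h, r)"
  shows "snd ((qmul e ^^ k) c) ^ nat h mod q \<noteq> r"
proof -
  from assms have e: "[snd e = 0] (mod q)" "[fst e ^ nat h = 1] (mod q)"
    and c: "snd c ^ nat h mod q \<noteq> r"
    using pow_mod[of q "fst e" h] pow_mod[of q "snd c" h]
    by (auto simp: cong_def) (metis mod_mod_trivial)
  have "[snd ((qmul e ^^ k) c) ^ nat h = snd c ^ nat h] (mod q)"
  proof (induction k)
    case (Suc k)
    obtain a b where ab: "e = (a, b)" by (cases e)
    obtain x y where xy: "(qmul e ^^ k) c = (x, y)" by fastforce
    \<comment> \<open>As \<open>q\<close> divides \<open>b\<close>, multiplying by \<open>e\<close>
      just scales the second coordinate by \<open>a\<close>.\<close>
    have "[a * y + b * x = a * y + 0 * x] (mod q)"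
      using e ab by (intro cong_add cong_mult) simp_all
    then have "[(a * y + b * x) ^ nat h = (a * y) ^ nat h] (mod q)" by (intro cong_pow) simp
    also have "(a * y) ^ nat h = a ^ nat h * y ^ nat h" by (rule power_mult_distrib)
    also have "[a ^ nat h * y ^ nat h = 1 * y ^ nat h] (mod q)" using e ab by (intro cong_mult) simp_all
    finally show ?case using Suc ab xy by (auto intro: cong_trans)
  qed simp
  then show ?thesis using c by (simp add: cong_def)
qed

text \<open>Since every \<open>q\<close> divides \<open>N\<close>, reduction modulo \<open>N\<close>
  preserves the constraints; the two recursive calls cover even and odd \<open>k\<close>.\<close>

lemma orbit_sieve_sound:
  assumes "orbit_sieve N ts e c"
    and "\<forall>(q, h, r)\<in>set (concat ts). q dvd N"
    and "qred N z = qred N ((qmul e ^^ k) c)"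
  shows "\<exists>(q, h, r)\<in>set (concat ts). snd z ^ nat h mod q \<noteq> r"
  using assms
proof (induction ts arbitrary: e c k)
  case (Cons t ts)
  show ?case
  proof (cases "list_ex (refutes e c) t")
    case True
    then obtain q h r where t: "(q, h, r) \<in> set t" "refutes e c (q, h, r)"
      by (auto simp: list_ex_iff)
    have "[snd z = snd ((qmul e ^^ k) c)] (mod N)"
      using Cons.prems(3) by (cases z; cases "(qmul e ^^ k) c") (simp add: cong_def)
    then have "[snd z = snd ((qmul e ^^ k) c)] (mod q)"
      using Cons.prems(2) t(1) by (auto intro: cong_dvd_modulus)
    then have "[snd z ^ nat h = snd ((qmul e ^^ k) c) ^ nat h] (mod q)" by (rule cong_pow)
    then have "snd z ^ nat h mod q \<noteq> r"
      using refutes_sound[OF t(2), of k] by (simp add: cong_def)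
    then show ?thesis using t(1) by force
  next
    case False
    let ?e = "qred N (qmul e e)"
    have sub: "orbit_sieve N ts ?e c" "orbit_sieve N ts ?e (qred N (qmul e c))"
      using Cons.prems(1) False by (auto split: if_splits)
    have dvd: "\<forall>(q, h, r)\<in>set (concat ts). q dvd N"
      using Cons.prems(2) unfolding concat.simps set_append by blast
    have "\<exists>(q, h, r)\<in>set (concat ts). snd z ^ nat h mod q \<noteq> r"
    proof (cases "even k")
      case True
      then obtain j where "k = 2 * j" by blast
      then have "qred N z = qred N ((qmul (qmul e e) ^^ j) c)"
        using Cons.prems(3) funpow_qmul_even by metis
      also have "\<dots> = qred N ((qmul ?e ^^ j) c)"
        by (metis qred_funpow_qmul qred_qred)
      finally show ?thesis by (rule Cons.IH[OF sub(1) dvd])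
    next
      case False
      then obtain j where "k = Suc (2 * j)" by (auto elim: oddE)
      then have "qred N z = qred N ((qmul (qmul e e) ^^ j) (qmul e c))"
        using Cons.prems(3) funpow_qmul_odd by metis
      then have "qred N z = qred N ((qmul ?e ^^ j) (qred N (qmul e c)))"
        by (simp add: qred_funpow_qmul)
      then show ?thesis by (rule Cons.IH[OF sub(2) dvd])
    qed
    then show ?thesis by auto
  qed
qed simp

text \<open>
  In the entries \<open>(q, h, 1)\<close> the even number \<open>h\<close> is the order of the group generated by
  \<open>-1\<close> and 6 modulo the prime \<open>q\<close>. The level of an entry is the least \<open>j\<close> for which
  \<open>(5 + 2 \<surd>6) ^ 2 ^ j\<close> satisfies the conditions in \<open>refutes\<close>.
\<close>

definition sieve_table :: "(int \<times> int \<times> int) list list" where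
  "sieve_table =
    [[(2, 1, 0)], [(4, 1, 0), (5, 2, 1)], [(8, 1, 0), (7, 2, 1)], [(16, 1, 0)],
     [(32, 1, 0), (31, 6, 1)], [(64, 1, 0)], [(128, 1, 0)], [(256, 1, 0)],
     [(512, 1, 0)], [(1024, 1, 0), (5119, 1706, 1)]]"

text \<open>The least common multiple of the moduli in the table.\<close>

definition sieve_modulus :: int where
  "sieve_modulus = 2 ^ 10 * 5 * 7 * 31 * 5119"

definition orbit_sieved :: "qint \<Rightarrow> bool" where
  "orbit_sieved c \<longleftrightarrow> orbit_sieve sieve_modulus sieve_table (5, 2) (qred sieve_modulus c)"

text \<open>For the entries with \<open>r = 1\<close>, even \<open>h\<close> removes the sign and
  \<open>6 ^ h\<close> is 1 modulo \<open>q\<close>; for the others, \<open>q\<close> divides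
  \<open>6 ^ 10\<close> and hence \<open>y\<close>.\<close>

lemma power_6_sieve_table:
  fixes y :: int
  assumes "\<bar>y\<bar> = 6 ^ m" "m \<ge> 10" "(q, h, r) \<in> set (concat sieve_table)"
  shows "y ^ nat h mod q = r"
proof -
  have ev: "y ^ nat h mod q = 1" if "even (nat h)" "pow_mod q 6 h mod q = 1"
  proof -
    have "[6 ^ nat h = 1] (mod q)"
      using that(2) pow_mod[of q 6 h] by (metis cong_def mod_mod_trivial)
    then have "[(6 ^ nat h) ^ m = 1 ^ m] (mod q)" by (rule cong_pow)
    moreover have "y ^ nat h = (6 ^ nat h) ^ m"
      using assms(1) that(1) by (metis power_even_abs power_mult mult.commute)
    ultimately show ?thesis using that(2) by (simp add: cong_def) (metis mod_mod_trivial)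
  qed
  have "(6::int) ^ 10 dvd y"
    using assms(1,2) le_imp_power_dvd[of 10 m "6::int"] by (metis dvd_abs_iff)
  then have two: "y mod q = 0" if "q dvd 6 ^ 10"
    using that dvd_trans by (auto simp: mod_eq_0_iff_dvd)
  have "list_all (\<lambda>(q, h, r). r = 1 \<and> h mod 2 = 0 \<and> pow_mod q 6 h mod q = 1 \<or>
      h = 1 \<and> r = 0 \<and> 6 ^ 10 mod q = 0) (concat sieve_table)"
    by code_simp
  then have "r = 1 \<and> h mod 2 = 0 \<and> pow_mod q 6 h mod q = 1 \<or> h = 1 \<and> r = 0 \<and> 6 ^ 10 mod q = 0"
    using assms(3) unfolding list_all_iff by blast
  then show ?thesis
  proof (elim disjE conjE)
    assume "r = 1" "h mod 2 = 0" "pow_mod q 6 h mod q = 1"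
    moreover from \<open>h mod 2 = 0\<close> have "even h" by presburger
    then have "even (nat h)" by (cases "h \<ge> 0") (simp_all add: even_nat_iff)
    ultimately show ?thesis using ev by simp
  next
    assume "h = 1" "r = 0" "6 ^ 10 mod q = 0"
    then show ?thesis using two by (simp add: mod_eq_0_iff_dvd)
  qed
qed

lemma no_solution_large_odd_exponent:
  fixes x :: nat
  assumes gs: "int d = prod_list (map qnorm gs)" "\<forall>g\<in>set gs. prime \<bar>qnorm g\<bar>"
    and sieve: "list_all orbit_sieved (norm_classes gs)"
    and "m \<ge> 10"
  shows "x\<^sup>2 \<noteq> 6 ^ (2 * m + 1) + d"
proof
  assume "x\<^sup>2 = 6 ^ (2 * m + 1) + d"
  then have "int (x\<^sup>2) = int (6 ^ (2 * m + 1) + d)" by (rule arg_cong)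
  then have "qnorm (int x, 6 ^ m) = int d" by (simp add: power_even_eq)
  then obtain c k where c: "c \<in> set (norm_classes gs)"
    and "\<bar>snd ((qmul (5, 2) ^^ k) c)\<bar> = \<bar>snd (int x, 6 ^ m :: int)\<bar>"
    using qnorm_eq_orbit gs by metis
  then have k: "\<bar>snd ((qmul (5, 2) ^^ k) c)\<bar> = 6 ^ m" by simp
  have "orbit_sieve sieve_modulus sieve_table (5, 2) (qred sieve_modulus c)"
    using sieve c by (simp add: list_all_iff orbit_sieved_def)
  moreover have "\<forall>(q, h, r)\<in>set (concat sieve_table). q dvd sieve_modulus"
    by (simp add: sieve_table_def sieve_modulus_def)
  moreover have "qred sieve_modulus ((qmul (5, 2) ^^ k) c)
      = qred sieve_modulus ((qmul (5, 2) ^^ k) (qred sieve_modulus c))"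
    by (metis qred_funpow_qmul qred_qred)
  ultimately have "\<exists>(q, h, r)\<in>set (concat sieve_table). snd ((qmul (5, 2) ^^ k) c) ^ nat h mod q \<noteq> r"
    by (rule orbit_sieve_sound)
  then show False using power_6_sieve_table[OF k \<open>m \<ge> 10\<close>] by blast
qed

section \<open>Small and even exponents\<close>

text \<open>A square above \<open>(b ^ m)\<^sup>2\<close> exceeds it by at least
  \<open>2 * b ^ m + 1\<close>.\<close>

lemma even_exponent_bound:
  fixes x b d m :: nat
  assumes "x\<^sup>2 = b ^ (2 * m) + d" "d > 0"
  shows "2 * b ^ m < d"
proof -
  have "(b ^ m)\<^sup>2 < x\<^sup>2" using assms by (simp add: power_even_eq)
  then have "b ^ m + 1 \<le> x" using power2_less_imp_less[of "b ^ m" x] by simp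
  then have "(b ^ m + 1)\<^sup>2 \<le> x\<^sup>2" by (rule power_mono) simp
  then show ?thesis using assms(1) by (simp add: power2_sum power_even_eq del: One_nat_def)
qed

text \<open>The list \<open>ss\<close> consists of the integer square roots of \<open>b ^ i + d\<close>.\<close>

lemma small_exponents:
  fixes x b d n :: nat
  assumes "list_all (\<lambda>(i, s). s\<^sup>2 \<le> b ^ i + d \<and> b ^ i + d < (s + 1)\<^sup>2 \<and>
      (s\<^sup>2 = b ^ i + d \<longrightarrow> i = 0 \<or> (s, i) \<in> A)) (List.enumerate 0 ss)"
    and "x\<^sup>2 = b ^ n + d" "n < length ss" "n > 0"
  shows "(x, n) \<in> A"
proof -
  have "(n, ss ! n) \<in> set (List.enumerate 0 ss)"
    using assms(3) by (simp add: in_set_enumerate_eq)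
  then have s: "(ss ! n)\<^sup>2 \<le> x\<^sup>2" "x\<^sup>2 < (ss ! n + 1)\<^sup>2" "(ss ! n)\<^sup>2 = x\<^sup>2 \<longrightarrow> (ss ! n, n) \<in> A"
    using assms by (auto simp: list_all_iff)
  have "ss ! n \<le> x" using s(1) by (rule power2_le_imp_le) simp
  moreover have "x < ss ! n + 1" using s(2) by (rule power2_less_imp_less) simp
  ultimately have "x = ss ! n" by simp
  then show ?thesis using s(3) by simp
qed

text \<open>Odd powers of 12 are 2 or 3 modulo 5, the quadratic nonresidues.\<close>

lemma odd_power_12_plus_nonsquare:
  fixes x :: nat
  assumes "5 dvd d"
  shows "x\<^sup>2 \<noteq> 12 ^ (2 * m + 1) + d"
proof
  assume "x\<^sup>2 = 12 ^ (2 * m + 1) + d"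
  then have eq: "x\<^sup>2 mod 5 = 12 ^ (2 * m + 1) mod 5"
    using assms by (metis add_0_right dvd_imp_mod_0 mod_add_right_eq)
  have "(12::nat) ^ (2 * m + 1) mod 5 \<in> {2, 3}"
  proof (induction m)
    case (Suc m)
    \<comment> \<open>Modulo 5, 144 is -1 and swaps 2 and 3.\<close>
    have "(12::nat) ^ (2 * Suc m + 1) = 144 * 12 ^ (2 * m + 1)" by simp
    moreover have "144 * t mod 5 \<in> {2, 3}" if "t mod 5 \<in> {2, 3}" for t :: nat
      using that by (auto simp: mod_mult_right_eq[of 144 t 5, symmetric])
    ultimately show ?case using Suc by metis
  qed simp
  moreover have "x\<^sup>2 mod 5 \<in> {0, 1, 4}"
  proof -
    have "x mod 5 = 0 \<or> x mod 5 = 1 \<or> x mod 5 = 2 \<or> x mod 5 = 3 \<or> x mod 5 = 4" by linarith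
    then have "(x mod 5)\<^sup>2 mod 5 \<in> {0, 1, 4}" by (elim disjE) simp_all
    then show ?thesis by (simp only: power_mod)
  qed
  ultimately show False using eq by auto
qed

text \<open>Even exponents \<open>2 * m\<close> satisfy \<open>m < 15\<close> by the size of
  \<open>d\<close>; odd exponents \<open>2 * m + 1\<close> satisfy \<open>m < 10\<close> by the
  sieve.\<close>

lemma solution_6_exponent_bound:
  fixes x n :: nat
  assumes eq: "x\<^sup>2 = 6 ^ n + d" and d: "0 < d" "d \<le> 2 * 6 ^ 15"
    and gs: "int d = prod_list (map qnorm gs)" "\<forall>g\<in>set gs. prime \<bar>qnorm g\<bar>"
    and sieve: "list_all orbit_sieved (norm_classes gs)"
  shows "n < 30"
proof (cases "even n")
  case True
  then obtain m where n: "n = 2 * m" by blast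
  then have "2 * 6 ^ m < d" using eq d by (intro even_exponent_bound) auto
  then have "(6::nat) ^ m < 6 ^ 15" using d by linarith
  then have "m < 15" by (simp only: power_strict_increasing_iff)
  then show ?thesis using n by simp
next
  case False
  then obtain m where n: "n = 2 * m + 1" by (elim oddE)
  then have "\<not> m \<ge> 10"
    using eq no_solution_large_odd_exponent[OF gs sieve] by blast
  then show ?thesis using n by simp
qed

section \<open>The three equations\<close>

text \<open>The listed elements have norms -5, 19, -23, with product 2185.\<close>

lemma sieve_2185:
  "list_all orbit_sieved (norm_classes [(1, 1), (5, 1), (1, 2)])"
  by code_simp

lemma solutions_6_2185: "solutions 6 2185 = {(49, 3), (59, 4), (221, 6)}"
proof
  let ?A = "{(49, 3), (59, 4), (221, 6)} :: (nat \<times> nat) set"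
  have "(x, n) \<in> ?A" if eq: "x\<^sup>2 = 6 ^ n + 2185" and "n > 0" for x n :: nat
  proof -
    have "n < 30"
      using eq by (rule solution_6_exponent_bound[OF _ _ _ _ _ sieve_2185]) simp_all
    then show ?thesis
      using that by (intro small_exponents[where b = 6 and d = 2185 and ss =
        "[46, 46, 47, 49, 59, 99, 221, 531, 1296, 3174, 7776, 19047, 46656, 114283,
         279936, 685700, 1679616, 4114202, 10077696, 24685212, 60466176, 148111277,
         362797056, 888667667, 2176782336, 5332006004, 13060694016, 31992036025,
         78364164096, 191952216154]"]) simp_all
  qed
  then show "solutions 6 2185 \<subseteq> ?A"
    by (auto simp only: solutions_def)
  show "?A \<subseteq> solutions 6 2185"
    by (simp add: solutions_def)
qed

text \<open>The norms are -5, -23, 43, -47, 73, 97, -167, with product 274837012705.\<close>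

lemma sieve_274837012705:
  "list_all orbit_sieved (norm_classes [(1, 1), (1, 2), (7, 1), (7, 4), (13, 4), (11, 2), (7, 6)])"
  by code_simp

lemma solutions_6_274837012705: "solutions 6 274837012705 = {(524249, 4), (526321, 12), (536561, 13)}"
proof
  let ?A = "{(524249, 4), (526321, 12), (536561, 13)} :: (nat \<times> nat) set"
  have "(x, n) \<in> ?A" if eq: "x\<^sup>2 = 6 ^ n + 274837012705" and "n > 0" for x n :: nat
  proof -
    have "n < 30"
      using eq by (rule solution_6_exponent_bound[OF _ _ _ _ _ sieve_274837012705]) simp_all
    then show ?thesis
      using that by (intro small_exponents[where b = 6 and d = 274837012705 and ss =
        "[524248, 524248, 524248, 524248, 524249, 524249, 524249, 524249, 524250, 524258,
         524306, 524594, 526321, 536561, 594307, 863146, 1759530, 4147468, 10091322,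
         24690779, 60468448, 148112205, 362797434, 888667822, 2176782399, 5332006030,
         13060694026, 31992036030, 78364164097, 191952216155]"]) simp_all
  qed
  then show "solutions 6 274837012705 \<subseteq> ?A"
    by (auto simp only: solutions_def)
  show "?A \<subseteq> solutions 6 274837012705"
    by (simp add: solutions_def)
qed

lemma solutions_12_25029865:
  "solutions 12 25029865 = {(5003, 2), (5293, 6), (21331, 8)}"
proof
  let ?A = "{(5003, 2), (5293, 6), (21331, 8)} :: (nat \<times> nat) set"
  have "(x, n) \<in> ?A" if eq: "x\<^sup>2 = 12 ^ n + 25029865" and "n > 0" for x n :: nat
  proof -
    have "even n"
    proof (rule ccontr)
      assume "odd n"
      then obtain m where "n = 2 * m + 1" by (elim oddE)
      then show False using eq odd_power_12_plus_nonsquare[of 25029865 x m] by simp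
    qed
    then obtain m where n: "n = 2 * m" by blast
    then have b: "2 * 12 ^ m < (25029865 :: nat)"
      using eq by (intro even_exponent_bound) auto
    \<comment> \<open>Already \<open>2 * 12 ^ 7\<close> exceeds 25029865.\<close>
    have "m < 7"
    proof (rule ccontr)
      assume "\<not> m < 7"
      then have "(12::nat) ^ 7 \<le> 12 ^ m" by (intro power_increasing) auto
      then show False using b by simp
    qed
    then have "n < 14" using n by simp
    then show ?thesis
      using that by (intro small_exponents[where b = 12 and d = 25029865 and ss =
        "[5002, 5002, 5003, 5003, 5005, 5027, 5293, 7801, 21331, 72005, 248882, 861993,
2985988, 10343753]"]) simp_all
  qed
  then show "solutions 12 25029865 \<subseteq> ?A"
    by (auto simp only: solutions_def)
  show "?A \<subseteq> solutions 12 25029865"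
    by (simp add: solutions_def)
qed

theorem theorem3p3:
  shows "(card (solutions 6 2185) = 3 \<and> snd ` solutions 6 2185 = {3, 4, 6})
    \<and> (card (solutions 6 274837012705) = 3 \<and> snd ` solutions 6 274837012705 = {4, 12, 13})
    \<and> (card (solutions 12 25029865) = 3 \<and> snd ` solutions 12 25029865 = {2, 6, 8})"
  by (simp add: solutions_6_2185 solutions_6_274837012705 solutions_12_25029865)

end
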